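(* Let $(S,\cdot,D,R)$ be an Ehresmann semigroup. Consider the following condition on a partial order $\leq$ on $S$: (OS4) for all $s,t\in S$, if $s\leq t$, $D(s)=D(t)$ and $R(s)=R(t)$, then $s=t$. If $(S,\cdot,D,R)$ is de Barros, then the ordered Ehresmann semigroup $(S,\cdot,D,R,\leq_e)$ satisfies (OS4). Conversely, if $(S,\cdot,D,R,\leq)$ is an ordered Ehresmann semigroup satisfying (OS4), then $(S,\cdot,D,R)$ is de Barros and $\leq$ is $\leq_e$.
   Context: An Ehresmann semigroup is a semigroup $(S,\cdot)$ with unary operations $D,R$ such that for all $s,t\in S$: $D(s)s=s$, $sR(s)=s$; $D(R(s))=R(s)$, $R(D(s))=D(s)$; $D(st)=D(sD(t))$, $R(st)=R(R(s)t)$; $D(D(s)D(t))=D(s)D(t)$; $D(s)D(t)=D(t)D(s)$. Put $D(S)=\{D(s)\mid s\in S\}=R(S)$. An ordered Ehresmann semigroup $(S,\cdot,D,R,\leq)$ is an Ehresmann semigroup with a partial order $\leq$ on $S$ such that: $a\leq b$ implies $D(a)\leq D(b)$ and $R(a)\leq R(b)$; $a\leq b$ and $c\leq d$ imply $ac\leq bd$; $ae\leq a$ and $ea\leq a$ for all $a\in S$, $e\in D(S)$; and if $a\in S$, $e\in D(S)$ and $a\leq e$ then $a\in D(S)$. Such a partial order is called an Ehresmann order. On an Ehresmann semigroup define partial orders: $s\leq_l t$ iff $s=D(s)t$; $s\leq_r t$ iff $s=tR(s)$. These permute as relations, and $\leq_e$ denotes their join, $\leq_e\,=\,\leq_l\circ\leq_r\,=\,\leq_r\circ\leq_l$,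 which is a partial order. An Ehresmann semigroup is de Barros if $\leq_e$ is compatible with multiplication ($a\leq_e b$ and $c\leq_e d$ imply $ac\leq_e bd$); equivalently, if $\leq_e$ is an Ehresmann order. *)

theory Defs
  imports Main
begin

locale ehresmann_semigroup = semigroup mult
  for mult :: "'a \<Rightarrow> 'a \<Rightarrow> 'a" (infixl "\<cdot>" 70) +
  fixes D R :: "'a \<Rightarrow> 'a"
  assumes D_left: "D s \<cdot> s = s"
    and R_right: "s \<cdot> R s = s"
    and D_R: "D (R s) = R s"
    and R_D: "R (D s) = D s"
    and D_mult: "D (s \<cdot> t) = D (s \<cdot> D t)"
    and R_mult: "R (s \<cdot> t) = R (R s \<cdot> t)"
    and D_closed: "D (D s \<cdot> D t) = D s \<cdot> D t"
    and D_commute: "D s \<cdot> D t = D t \<cdot> D s"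

locale ordered_ehresmann_semigroup = ehresmann_semigroup mult D R
  for mult :: "'a \<Rightarrow> 'a \<Rightarrow> 'a" (infixl "\<cdot>" 70) and D R :: "'a \<Rightarrow> 'a" +
  fixes le :: "'a \<Rightarrow> 'a \<Rightarrow> bool" (infix "\<preceq>" 50)
  assumes refl_le: "reflp (\<preceq>)"
    and antisym_le: "antisymp (\<preceq>)"
    and trans_le: "transp (\<preceq>)"
    and D_mono: "a \<preceq> b \<Longrightarrow> D a \<preceq> D b"
    and R_mono: "a \<preceq> b \<Longrightarrow> R a \<preceq> R b"
    and mult_mono: "a \<preceq> b \<Longrightarrow> c \<preceq> d \<Longrightarrow> a \<cdot> c \<preceq> b \<cdot> d"
    and mult_proj_right: "e \<in> range D \<Longrightarrow> a \<cdot> e \<preceq> a"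
    and mult_proj_left: "e \<in> range D \<Longrightarrow> e \<cdot> a \<preceq> a"
    and proj_down_closed: "e \<in> range D \<Longrightarrow> a \<preceq> e \<Longrightarrow> a \<in> range D"

definition OS4 :: "('a \<Rightarrow> 'a) \<Rightarrow> ('a \<Rightarrow> 'a) \<Rightarrow> ('a \<Rightarrow> 'a \<Rightarrow> bool) \<Rightarrow> bool" where
  "OS4 D R le \<longleftrightarrow> (\<forall>s t. le s t \<and> D s = D t \<and> R s = R t \<longrightarrow> s = t)"

definition le_l :: "('a \<Rightarrow> 'a \<Rightarrow> 'a) \<Rightarrow> ('a \<Rightarrow> 'a) \<Rightarrow> 'a \<Rightarrow> 'a \<Rightarrow> bool" where
  "le_l mult D s t \<longleftrightarrow> s = mult (D s) t"

definition le_r :: "('a \<Rightarrow> 'a \<Rightarrow> 'a) \<Rightarrow> ('a \<Rightarrow> 'a) \<Rightarrow> 'a \<Rightarrow> 'a \<Rightarrow> bool" where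
  "le_r mult R s t \<longleftrightarrow> s = mult t (R s)"

text \<open>The order of composition is immaterial, and the composite is the join of the two
  partial orders: see \<open>le_l_le_r_commute\<close>, \<open>partial_order_le_e\<close> and \<open>le_e_join\<close> below.\<close>

definition le_e ::
  "('a \<Rightarrow> 'a \<Rightarrow> 'a) \<Rightarrow> ('a \<Rightarrow> 'a) \<Rightarrow> ('a \<Rightarrow> 'a) \<Rightarrow> 'a \<Rightarrow> 'a \<Rightarrow> bool" where
  "le_e mult D R = le_l mult D OO le_r mult R"

locale de_barros_semigroup = ehresmann_semigroup mult D R
  for mult :: "'a \<Rightarrow> 'a \<Rightarrow> 'a" (infixl "\<cdot>" 70) and D R :: "'a \<Rightarrow> 'a" +
  assumes le_e_mult_mono:
    "le_e mult D R a b \<Longrightarrow> le_e mult D R c d \<Longrightarrow> le_e mult D R (a \<cdot> c) (b \<cdot> d)"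

context ehresmann_semigroup
begin

lemma D_D: "D (D s) = D s"
  by (metis D_R R_D)

lemma R_R: "R (R s) = R s"
  by (metis D_R R_D)

lemma R_closed: "R (R s \<cdot> R t) = R s \<cdot> R t"
  by (metis D_R D_closed R_D)

lemma D_D_mult: "D (D x \<cdot> t) = D x \<cdot> D t"
  by (metis D_mult D_closed)

lemma R_mult_R: "R (t \<cdot> R x) = R t \<cdot> R x"
  by (metis R_mult R_closed)

lemma le_l_iff: "le_l mult D s t \<longleftrightarrow> (\<exists>x. s = D x \<cdot> t)"
proof
  assume "\<exists>x. s = D x \<cdot> t"
  then obtain x where x: "s = D x \<cdot> t" by blast
  have "D s \<cdot> t = D x \<cdot> (D t \<cdot> t)" using D_D_mult x assoc by metis
  then show "le_l mult D s t" unfolding le_l_def using x D_left by metis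
qed (auto simp: le_l_def)

lemma le_r_iff: "le_r mult R s t \<longleftrightarrow> (\<exists>x. s = t \<cdot> R x)"
proof
  assume "\<exists>x. s = t \<cdot> R x"
  then obtain x where x: "s = t \<cdot> R x" by blast
  have "t \<cdot> R s = (t \<cdot> R t) \<cdot> R x" using R_mult_R x assoc by metis
  then show "le_r mult R s t" unfolding le_r_def using x R_right by metis
qed (auto simp: le_r_def)

lemma le_e_iff: "le_e mult D R s t \<longleftrightarrow> (\<exists>x y. s = D x \<cdot> t \<cdot> R y)"
  unfolding le_e_def OO_def le_l_iff le_r_iff using assoc by metis

lemma le_l_le_r_commute: "le_l mult D OO le_r mult R = le_r mult R OO le_l mult D"
proof (intro ext)
  fix s t
  have "(le_r mult R OO le_l mult D) s t \<longleftrightarrow> (\<exists>x y. s = D x \<cdot> t \<cdot> R y)"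
    unfolding OO_def le_l_iff le_r_iff by metis
  then show "(le_l mult D OO le_r mult R) s t = (le_r mult R OO le_l mult D) s t"
    using le_e_iff unfolding le_e_def by simp
qed

lemma partial_order_le_l: "reflp (le_l mult D)" "antisymp (le_l mult D)" "transp (le_l mult D)"
proof -
  show "reflp (le_l mult D)" by (simp add: reflp_def le_l_def D_left)
  show "antisymp (le_l mult D)"
    by (rule antisympI) (metis le_l_def D_commute D_left assoc)
  show "transp (le_l mult D)"
    by (rule transpI) (metis le_l_iff D_closed assoc)
qed

lemma partial_order_le_r: "reflp (le_r mult R)" "antisymp (le_r mult R)" "transp (le_r mult R)"
proof -
  show "reflp (le_r mult R)" by (simp add: reflp_def le_r_def R_right)
  show "antisymp (le_r mult R)"
    by (rule antisympI) (metis le_r_def D_commute D_R R_right assoc)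
  show "transp (le_r mult R)"
    by (rule transpI) (metis le_r_iff R_closed assoc)
qed

lemma partial_order_le_e:
  "reflp (le_e mult D R)" "antisymp (le_e mult D R)" "transp (le_e mult D R)"
proof -
  show "reflp (le_e mult D R)"
    by (rule reflpI) (metis le_e_iff D_left R_right)
  show "transp (le_e mult D R)"
  proof (rule transpI)
    fix s t u assume "le_e mult D R s t" "le_e mult D R t u"
    then obtain a b c d where "s = D a \<cdot> t \<cdot> R b" "t = D c \<cdot> u \<cdot> R d"
      unfolding le_e_iff by blast
    then have "s = (D a \<cdot> D c) \<cdot> u \<cdot> (R d \<cdot> R b)" by (simp add: assoc)
    then show "le_e mult D R s u" unfolding le_e_iff by (metis D_closed R_closed)
  qed
  show "antisymp (le_e mult D R)"
  proof (rule antisympI)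
    fix s t assume "le_e mult D R s t" "le_e mult D R t s"
    then obtain a b c d where s: "s = D a \<cdot> t \<cdot> R b" and t: "t = D c \<cdot> s \<cdot> R d"
      unfolding le_e_iff by blast
    have "D a \<cdot> s = s" using s by (metis D_D D_commute D_left D_closed assoc)
    then have "D a \<cdot> t = t" using t D_commute assoc by metis
    moreover have "s \<cdot> R b = s" using s by (metis R_right R_R R_closed assoc)
    then have "t \<cdot> R b = t" using t D_commute D_R assoc by metis
    ultimately show "s = t" using s by simp
  qed
qed

lemma le_e_join:
  "le_l mult D \<le> le_e mult D R" "le_r mult R \<le> le_e mult D R"
  "transp q \<Longrightarrow> le_l mult D \<le> q \<Longrightarrow> le_r mult R \<le> q \<Longrightarrow> le_e mult D R \<le> q"
proof -
  show "le_l mult D \<le> le_e mult D R"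
    unfolding le_e_def using partial_order_le_r(1) by (auto simp: OO_def reflp_def)
  show "le_r mult R \<le> le_e mult D R"
    unfolding le_e_def using partial_order_le_l(1) by (auto simp: OO_def reflp_def)
  show "transp q \<Longrightarrow> le_l mult D \<le> q \<Longrightarrow> le_r mult R \<le> q \<Longrightarrow> le_e mult D R \<le> q"
    unfolding le_e_def by (auto simp: OO_def transp_def)
qed

end

end

theory Submission
  imports Defs
begin

text \<open>
  The elements below \<open>t\<close> in \<open>\<le>\<^sub>e\<close> are exactly the \<open>e \<cdot> t \<cdot> f\<close> with projections \<open>e\<close> and \<open>f\<close>.
  Such an element is obtained from \<open>t\<close> by cutting down its domain and range.  If both survive
  uncut, then \<open>e\<close> and \<open>f\<close> act as identities on \<open>t\<close> and nothing has changed, which is (OS4)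
  for \<open>\<le>\<^sub>e\<close>.  This and the axioms of an Ehresmann order other than compatibility with
  multiplication hold in every Ehresmann semigroup; compatibility is the de Barros condition.

  Conversely, multiplying by projections decreases elements in any Ehresmann order \<open>\<preceq>\<close>, so \<open>\<preceq>\<close>
  contains \<open>\<le>\<^sub>e\<close>.  If \<open>a \<preceq> b\<close>, then the restriction \<open>c = D a \<cdot> b \<cdot> R a\<close> of \<open>b\<close> satisfies
  \<open>a = D a \<cdot> a \<cdot> R a \<preceq> c\<close> and has the same domain and range as \<open>a\<close>.  Hence (OS4) forces \<open>a = c\<close>,
  and \<open>c \<le>\<^sub>e b\<close>.  So \<open>\<preceq>\<close> is \<open>\<le>\<^sub>e\<close>, which therefore inherits compatibility.
\<close>

context ehresmann_semigroup
begin

lemma range_D_eq_range_R: "range D = range R"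
proof (intro subset_antisym image_subsetI)
  fix x
  show "D x \<in> range R" by (rule range_eqI[of _ _ "D x"]) (simp add: R_D)
  show "R x \<in> range D" by (rule range_eqI[of _ _ "R x"]) (simp add: D_R)
qed

lemma R_commute: "R s \<cdot> R t = R t \<cdot> R s"
  using D_commute[of "R s" "R t"] by (simp add: D_R)

text \<open>The natural order on projections, which form a semilattice, is the restriction of \<open>\<le>\<^sub>e\<close>.\<close>

lemma le_e_projI: "D s \<cdot> D t = D s \<Longrightarrow> le_e mult D R (D s) (D t)"
  unfolding le_e_iff by (metis R_right)

lemma D_mult_le: "D (t \<cdot> u) \<cdot> D t = D (t \<cdot> u)"
proof -
  have "D (t \<cdot> u) = D (D t \<cdot> (t \<cdot> u))"
    by (simp add: D_left flip: assoc)
  also have "\<dots> = D (t \<cdot> u) \<cdot> D t"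
    by (simp only: D_D_mult D_commute)
  finally show ?thesis by simp
qed

lemma R_mult_le: "R (u \<cdot> t) \<cdot> R t = R (u \<cdot> t)"
proof -
  have "R (u \<cdot> t) = R (u \<cdot> t \<cdot> R t)"
    by (simp add: R_right assoc)
  also have "\<dots> = R (u \<cdot> t) \<cdot> R t"
    by (rule R_mult_R)
  finally show ?thesis by simp
qed

lemma le_e_D_mono:
  assumes "le_e mult D R s t"
  shows "le_e mult D R (D s) (D t)"
proof (rule le_e_projI)
  obtain x y where s: "s = D x \<cdot> (t \<cdot> R y)"
    using assms unfolding le_e_iff by (metis assoc)
  then show "D s \<cdot> D t = D s"
    by (simp add: D_D_mult D_mult_le assoc)
qed

lemma le_e_R_mono:
  assumes "le_e mult D R s t"
  shows "le_e mult D R (R s) (R t)"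
proof -
  obtain x y where s: "s = (D x \<cdot> t) \<cdot> R y"
    using assms unfolding le_e_iff by metis
  then have "R s = R y \<cdot> R (D x \<cdot> t)"
    by (simp only: R_mult_R R_commute)
  then have "R s \<cdot> R t = R s"
    by (simp only: R_mult_le assoc)
  then show ?thesis
    using le_e_projI[of "R s" "R t"] by (simp add: D_R)
qed

lemma le_e_mult_proj_right: "e \<in> range D \<Longrightarrow> le_e mult D R (a \<cdot> e) a"
  unfolding le_e_iff by (metis D_left R_D imageE)

lemma le_e_mult_proj_left: "e \<in> range D \<Longrightarrow> le_e mult D R (e \<cdot> a) a"
  unfolding le_e_iff by (metis R_right assoc imageE)

lemma le_e_proj_down_closed:
  assumes "e \<in> range D" "le_e mult D R a e"
  shows "a \<in> range D"
proof -
  obtain x y z where "a = D x \<cdot> D z \<cdot> D (R y)"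
    using assms unfolding le_e_iff by (metis D_R imageE)
  then have "a = D a"
    by (metis D_closed)
  then show ?thesis by blast
qed

text \<open>If \<open>s = e \<cdot> t \<cdot> f\<close>, then \<open>e\<close> fixes \<open>s\<close>, hence lies above \<open>D s = D t\<close>, hence fixes \<open>t\<close>;
  dually for \<open>f\<close>.\<close>

lemma OS4_le_e: "OS4 D R (le_e mult D R)"
  unfolding OS4_def
proof (intro allI impI, elim conjE)
  fix s t assume "le_e mult D R s t" and D: "D s = D t" and R: "R s = R t"
  then obtain x y where s: "s = D x \<cdot> t \<cdot> R y"
    unfolding le_e_iff by blast
  have "D x \<cdot> D s = D s"
  proof -
    have "D s = D x \<cdot> D (t \<cdot> R y)"
      unfolding s by (simp only: assoc D_D_mult)
    moreover have "D x \<cdot> D x = D x"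
      using D_left[of "D x"] by (simp only: D_D)
    ultimately show ?thesis
      by (simp flip: assoc)
  qed
  then have "D x \<cdot> t = t"
    using D by (metis D_left assoc)
  moreover have "R s \<cdot> R y = R s"
  proof -
    have "R s = R (D x \<cdot> t) \<cdot> R y"
      unfolding s by (rule R_mult_R)
    moreover have "R y \<cdot> R y = R y"
      using R_right[of "R y"] by (simp only: R_R)
    ultimately show ?thesis
      by (simp add: assoc)
  qed
  then have "t \<cdot> R y = t"
    using R by (metis R_right assoc)
  ultimately show "s = t" using s by simp
qed

end

lemma (in de_barros_semigroup) ordered_ehresmann_semigroup_le_e:
  "ordered_ehresmann_semigroup mult D R (le_e mult D R)"
  by unfold_locales
    (fact partial_order_le_e le_e_D_mono le_e_R_mono le_e_mult_mono le_e_mult_proj_right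
      le_e_mult_proj_left le_e_proj_down_closed)+

context ordered_ehresmann_semigroup
begin

lemma le_e_imp_le: "le_e mult D R a b \<Longrightarrow> a \<preceq> b"
proof -
  assume "le_e mult D R a b"
  then obtain x y where "a = D x \<cdot> b \<cdot> R y"
    unfolding le_e_iff by blast
  then have "a \<preceq> D x \<cdot> b"
    by (simp add: mult_proj_right range_D_eq_range_R)
  moreover have "D x \<cdot> b \<preceq> b"
    by (simp add: mult_proj_left)
  ultimately show "a \<preceq> b"
    using trans_le by (rule transpD[rotated])
qed

text \<open>The domain of \<open>c = D a \<cdot> b \<cdot> R a\<close> is at most \<open>D a\<close> because of its left factor, and at least
  \<open>D a\<close> because \<open>a \<preceq> c\<close>; dually for the range.\<close>

lemma OS4_imp_restriction_eq:
  assumes "OS4 D R (\<preceq>)" "a \<preceq> b"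
  shows "a = D a \<cdot> b \<cdot> R a"
proof -
  let ?c = "D a \<cdot> b \<cdot> R a"
  have "D a \<cdot> a \<cdot> R a \<preceq> ?c"
    by (intro mult_mono assms(2) reflpD[OF refl_le])
  then have ac: "a \<preceq> ?c"
    by (simp add: D_left R_right)
  have "D ?c \<preceq> D a"
    by (simp add: D_D_mult assoc mult_proj_right)
  then have "D a = D ?c"
    using D_mono[OF ac] antisympD[OF antisym_le] by blast
  moreover have "R ?c \<preceq> R a"
    by (simp add: R_mult_R mult_proj_left range_D_eq_range_R)
  then have "R a = R ?c"
    using R_mono[OF ac] antisympD[OF antisym_le] by blast
  ultimately show ?thesis
    using assms(1) ac unfolding OS4_def by blast
qed

lemma OS4_imp_le_eq_le_e:
  assumes "OS4 D R (\<preceq>)"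
  shows "(\<preceq>) = le_e mult D R"
proof (intro ext iffI)
  fix a b assume "a \<preceq> b"
  then show "le_e mult D R a b"
    unfolding le_e_iff using OS4_imp_restriction_eq[OF assms] by blast
qed (rule le_e_imp_le)

lemma OS4_imp_de_barros:
  assumes "OS4 D R (\<preceq>)"
  shows "de_barros_semigroup mult D R"
  by unfold_locales (fold OS4_imp_le_eq_le_e[OF assms], rule mult_mono)

end

theorem proposition3p11:
  fixes mult :: "'a \<Rightarrow> 'a \<Rightarrow> 'a" and D R :: "'a \<Rightarrow> 'a"
  assumes "ehresmann_semigroup mult D R"
  shows "(de_barros_semigroup mult D R \<longrightarrow>
            ordered_ehresmann_semigroup mult D R (le_e mult D R) \<and> OS4 D R (le_e mult D R)) \<and>
         (\<forall>le. ordered_ehresmann_semigroup mult D R le \<and> OS4 D R le \<longrightarrow>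
            de_barros_semigroup mult D R \<and> le = le_e mult D R)"
  using de_barros_semigroup.ordered_ehresmann_semigroup_le_e
    ehresmann_semigroup.OS4_le_e[OF assms]
    ordered_ehresmann_semigroup.OS4_imp_de_barros
    ordered_ehresmann_semigroup.OS4_imp_le_eq_le_e
  by blast

end
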